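(* Let $\mathbf{S}=\mathcal{M}[G;I,\Lambda;P]$ be a completely simple semigroup (given by a normalized Rees matrix representation), and let $\rho,\sigma$ be congruences on $\mathbf{S}$. Then the commutator $[\rho,\sigma]$ corresponds to the linked triple $(0_I,\,[\rho_G,\sigma_G]\vee\Theta_{\rho,\sigma},\,0_\Lambda)$; that is, $[\rho,\sigma]_I=0_I$, $[\rho,\sigma]_G=[\rho_G,\sigma_G]\vee\Theta_{\rho,\sigma}$ and $[\rho,\sigma]_\Lambda=0_\Lambda$.
   Context: Commutators. $\mathbb{N}=\{1,2,\dots\}$. For an algebra $\mathbf{A}$ and congruences $\alpha,\beta,\delta$ of $\mathbf{A}$, $C(\alpha,\beta;\delta)$ ("$\alpha$ centralizes $\beta$ modulo $\delta$") means: for all $n\in\mathbb{N}$, all $(n+1)$-ary term functions $t$ of $\mathbf{A}$, all $a,b\in A$ and $\mathbf{c},\mathbf{d}\in A^n$ with $a\,\alpha\,b$ and $c_i\,\beta\,d_i$ for every $i$, $t(a,\mathbf{c})\,\delta\,t(a,\mathbf{d})$ implies $t(b,\mathbf{c})\,\delta\,t(b,\mathbf{d})$. The commutator $[\alpha,\beta]$ is the least congruence $\delta$ with $C(\alpha,\beta;\delta)$. Semigroups are algebras with one binary operation; groups are algebras $(G,\cdot,{}^{-1},e)$. $0_X$ is the equality relation and $1_X$ the full relation on a set $X$; $\vee$ is the join in the congruence lattice. Rees matrix semigroups. Let $\mathbf{G}$ be a group with identity $e$, $I,\Lambda$ sets with an element $1\in I\cap\Lambda$, and $P=[p_{\lambda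 i}]$ a $\Lambda\times I$ matrix over $G$ with $p_{1i}=e=p_{\lambda 1}$ for all $i\in I,\lambda\in\Lambda$ (normalization). $\mathcal{M}[G;I,\Lambda;P]$ is the semigroup on $I\times G\times\Lambda$ with $(i,g,\lambda)(j,h,\mu)=(i,gp_{\lambda j}h,\mu)$. Every completely simple semigroup (a simple semigroup containing a primitive idempotent) is isomorphic to one of these. Components of a congruence $\rho$ on $\mathbf{S}=\mathcal{M}[G;I,\Lambda;P]$: $\rho_I=\{(i,j)\in I^2:(\forall\lambda\in\Lambda)\ (i,p_{\lambda i}^{-1},\lambda)\,\rho\,(j,p_{\lambda j}^{-1},\lambda)\}$; $\rho_\Lambda=\{(\lambda,\mu)\in\Lambda^2:(\forall i\in I)\ (i,p_{\lambda i}^{-1},\lambda)\,\rho\,(i,p_{\mu i}^{-1},\mu)\}$; $\rho_G$ is the congruence on $\mathbf{G}$ with $a\,\rho_G\,b\iff(1,a,1)\,\rho\,(1,b,1)$. A linked triple is a triple $(\varepsilon,\tau,\eta)$ where $\varepsilon$ is an equivalence on $I$, $\tau$ a congruence on $\mathbf{G}$, $\eta$ an equivalence on $\Lambda$, such that $p_{\lambda i}p_{\mu i}^{-1}p_{\mu j}p_{\lambda j}^{-1}\,\tau\,e$ holds whenever $i\,\varepsilon\,j$ (for all $\lambda,\mu\in\Lambda$) and whenever $\lambda\,\eta\,\mu$ (for all $i,j\in I$). The map $\rho\mapsto(\rho_I,\rho_G,\rho_\Lambda)$ is an order-preserving bijection from the congruences of $\mathbf{S}$ to the linked triples; a congruence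 corresponds to (is determined by) its linked triple under this bijection. $\Theta_{\rho,\sigma}$ is the congruence on $\mathbf{G}$ generated by all pairs $(p_{\mu i}p_{\lambda i}^{-1},\,p_{\mu j}p_{\lambda j}^{-1})$ where $i,j\in I$, $\lambda,\mu\in\Lambda$ are such that ($i\,\rho_I\,j$ and $\lambda\,\sigma_\Lambda\,\mu$) or ($\lambda\,\rho_\Lambda\,\mu$ and $i\,\sigma_I\,j$). *)

theory Defs
  imports "HOL-Algebra.Group"
begin

section \<open>Algebras, term functions, congruences and commutators\<close>

(* An operation is a pair (arity, function on argument lists); only its values on
   lists of that length over the carrier matter.  Term functions, congruences and
   commutators of a single algebra do not depend on the names of the operations,
   so the signature is left implicit. *)
record 'a ualgebra = "'a partial_object" +
  operations :: "(nat \<times> ('a list \<Rightarrow> 'a)) set"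

definition is_algebra :: "'a ualgebra \<Rightarrow> bool" where
  "is_algebra A \<longleftrightarrow>
     (\<forall>(n, f) \<in> operations A. \<forall>xs. length xs = n \<and> set xs \<subseteq> carrier A \<longrightarrow> f xs \<in> carrier A)"

inductive term_function :: "'a ualgebra \<Rightarrow> nat \<Rightarrow> ('a list \<Rightarrow> 'a) \<Rightarrow> bool"
  for A :: "'a ualgebra" and n :: nat where
  projection: "i < n \<Longrightarrow> term_function A n (\<lambda>xs. xs ! i)"
| composition: "\<lbrakk>(m, f) \<in> operations A; length ts = m; \<forall>t \<in> set ts. term_function A n t\<rbrakk>
     \<Longrightarrow> term_function A n (\<lambda>xs. f (map (\<lambda>t. t xs) ts))"

definition is_congruence :: "'a ualgebra \<Rightarrow> 'a rel \<Rightarrow> bool" where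
  "is_congruence A \<theta> \<longleftrightarrow> equiv (carrier A) \<theta> \<and>
     (\<forall>(n, f) \<in> operations A. \<forall>xs ys.
        length xs = n \<and> list_all2 (\<lambda>x y. (x, y) \<in> \<theta>) xs ys \<longrightarrow> (f xs, f ys) \<in> \<theta>)"

(* The tuples c and d have length n >= 1, and t is (n+1)-ary. *)
definition centralizes :: "'a ualgebra \<Rightarrow> 'a rel \<Rightarrow> 'a rel \<Rightarrow> 'a rel \<Rightarrow> bool" where
  "centralizes A \<alpha> \<beta> \<delta> \<longleftrightarrow>
     (\<forall>n\<ge>1. \<forall>t a b c d.
        term_function A (Suc n) t \<and> (a, b) \<in> \<alpha> \<and>
        length c = n \<and> length d = n \<and> (\<forall>i<n. (c ! i, d ! i) \<in> \<beta>) \<and>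
        (t (a # c), t (a # d)) \<in> \<delta> \<longrightarrow> (t (b # c), t (b # d)) \<in> \<delta>)"

(* The order on relations is inclusion; that the least elements below exist is
   shown in the lemmas commutator_least, generated_congruence_least and
   congruence_join_least. *)
definition commutator :: "'a ualgebra \<Rightarrow> 'a rel \<Rightarrow> 'a rel \<Rightarrow> 'a rel" where
  "commutator A \<alpha> \<beta> = (LEAST \<delta>. is_congruence A \<delta> \<and> centralizes A \<alpha> \<beta> \<delta>)"

definition generated_congruence :: "'a ualgebra \<Rightarrow> 'a rel \<Rightarrow> 'a rel" where
  "generated_congruence A X = (LEAST \<theta>. is_congruence A \<theta> \<and> X \<subseteq> \<theta>)"

definition congruence_join :: "'a ualgebra \<Rightarrow> 'a rel \<Rightarrow> 'a rel \<Rightarrow> 'a rel" where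
  "congruence_join A \<alpha> \<beta> = (LEAST \<theta>. is_congruence A \<theta> \<and> \<alpha> \<subseteq> \<theta> \<and> \<beta> \<subseteq> \<theta>)"

lemma term_function_closed:
  assumes "is_algebra A" "term_function A n t" "length xs = n" "set xs \<subseteq> carrier A"
  shows "t xs \<in> carrier A"
  using assms(2)
proof induction
  case (projection i)
  then show ?case using assms(3,4) nth_mem by blast
next
  case (composition m f ts)
  then have "set (map (\<lambda>t. t xs) ts) \<subseteq> carrier A" "length (map (\<lambda>t. t xs) ts) = m"
    by auto
  then show ?case using assms(1) composition(1) unfolding is_algebra_def by blast
qed

lemma full_congruence:
  assumes "is_algebra A"
  shows "is_congruence A (carrier A \<times> carrier A)"
proof -
  have "f xs \<in> carrier A \<and> f ys \<in> carrier A"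
    if "(n, f) \<in> operations A" "length xs = n"
      "list_all2 (\<lambda>x y. (x, y) \<in> carrier A \<times> carrier A) xs ys" for n f xs ys
  proof -
    have "set xs \<subseteq> carrier A" "set ys \<subseteq> carrier A" "length ys = n"
      using that(2,3) by (auto simp: list_all2_conv_all_nth in_set_conv_nth)
    then show ?thesis using assms that(1,2) unfolding is_algebra_def by blast
  qed
  moreover have "equiv (carrier A) (carrier A \<times> carrier A)"
    by (auto simp: equiv_def refl_on_def sym_def trans_def)
  ultimately show ?thesis unfolding is_congruence_def by auto
qed

lemma Inter_congruence:
  assumes "F \<noteq> {}" "\<And>\<theta>. \<theta> \<in> F \<Longrightarrow> is_congruence A \<theta>"
  shows "is_congruence A (\<Inter>F)"
proof -
  have eq: "\<theta> \<subseteq> carrier A \<times> carrier A" "refl_on (carrier A) \<theta>" "sym \<theta>" "trans \<theta>"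
    if "\<theta> \<in> F" for \<theta>
    using assms(2)[OF that] unfolding is_congruence_def equiv_def by auto
  have "equiv (carrier A) (\<Inter>F)"
  proof (rule equivI)
    show "\<Inter>F \<subseteq> carrier A \<times> carrier A" using eq(1) assms(1) by blast
    show "refl_on (carrier A) (\<Inter>F)" using eq(2) by (auto simp: refl_on_def)
    show "sym (\<Inter>F)" using eq(3) by (fastforce simp: sym_def)
    show "trans (\<Inter>F)" using eq(4) by (fastforce simp: trans_def)
  qed
  moreover have "(f xs, f ys) \<in> \<Inter>F"
    if "(n, f) \<in> operations A" "length xs = n"
      "list_all2 (\<lambda>x y. (x, y) \<in> \<Inter>F) xs ys" for n f xs ys
  proof
    fix \<theta> assume \<theta>: "\<theta> \<in> F"
    have "list_all2 (\<lambda>x y. (x, y) \<in> \<theta>) xs ys"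
      using that(3) \<theta> by (auto elim: list_all2_mono)
    then show "(f xs, f ys) \<in> \<theta>"
      using assms(2)[OF \<theta>] that(1,2) unfolding is_congruence_def by blast
  qed
  ultimately show ?thesis unfolding is_congruence_def by auto
qed

lemma Least_congruence:
  assumes "is_congruence A \<theta>\<^sub>0" "P \<theta>\<^sub>0"
    and "\<And>F. \<lbrakk>F \<noteq> {}; \<And>\<theta>. \<theta> \<in> F \<Longrightarrow> P \<theta>\<rbrakk> \<Longrightarrow> P (\<Inter>F)"
  defines "m \<equiv> (LEAST \<theta>. is_congruence A \<theta> \<and> P \<theta>)"
  shows "is_congruence A m" "P m" "\<And>\<theta>. is_congruence A \<theta> \<Longrightarrow> P \<theta> \<Longrightarrow> m \<subseteq> \<theta>"
    "m = \<Inter>{\<theta>. is_congruence A \<theta> \<and> P \<theta>}"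
proof -
  let ?F = "{\<theta>. is_congruence A \<theta> \<and> P \<theta>}"
  have "?F \<noteq> {}" using assms(1,2) by auto
  then have I: "is_congruence A (\<Inter>?F)" "P (\<Inter>?F)"
    by (rule Inter_congruence assms(3), simp)+
  show m: "m = \<Inter>?F"
    unfolding m_def by (rule Least_equality) (use I in auto)
  show "is_congruence A m" "P m" unfolding m using I .
  show "\<And>\<theta>. is_congruence A \<theta> \<Longrightarrow> P \<theta> \<Longrightarrow> m \<subseteq> \<theta>" unfolding m by auto
qed

lemma commutator_least:
  assumes "is_algebra A" "is_congruence A \<alpha>" "is_congruence A \<beta>"
  shows "is_congruence A (commutator A \<alpha> \<beta>)"
    "centralizes A \<alpha> \<beta> (commutator A \<alpha> \<beta>)"
    "\<And>\<delta>. is_congruence A \<delta> \<Longrightarrow> centralizes A \<alpha> \<beta> \<delta> \<Longrightarrow> commutator A \<alpha> \<beta> \<subseteq> \<delta>"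
    "commutator A \<alpha> \<beta> = \<Inter>{\<delta>. is_congruence A \<delta> \<and> centralizes A \<alpha> \<beta> \<delta>}"
proof -
  have sub: "\<alpha> \<subseteq> carrier A \<times> carrier A" "\<beta> \<subseteq> carrier A \<times> carrier A"
    using assms(2,3) unfolding is_congruence_def equiv_def by auto
  have full: "centralizes A \<alpha> \<beta> (carrier A \<times> carrier A)"
    unfolding centralizes_def
  proof (intro allI impI, elim conjE)
    fix n t a b c d
    assume *: "term_function A (Suc n) t" "(a, b) \<in> \<alpha>" "length c = n" "length d = n"
      "\<forall>i<n. (c ! i, d ! i) \<in> \<beta>"
    have "set (b # c) \<subseteq> carrier A" "set (b # d) \<subseteq> carrier A"
      using * sub by (fastforce simp: in_set_conv_nth)+
    then show "(t (b # c), t (b # d)) \<in> carrier A \<times> carrier A"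
      using * term_function_closed[OF assms(1) *(1)] by auto
  qed
  have inter: "centralizes A \<alpha> \<beta> (\<Inter>F)" if "\<And>\<theta>. \<theta> \<in> F \<Longrightarrow> centralizes A \<alpha> \<beta> \<theta>" for F
    unfolding centralizes_def
  proof (intro allI impI, elim conjE, rule InterI)
    fix n t a b c d \<theta>
    assume *: "1 \<le> (n::nat)" "term_function A (Suc n) t" "(a, b) \<in> \<alpha>" "length c = n" "length d = n"
      "\<forall>i<n. (c ! i, d ! i) \<in> \<beta>" "(t (a # c), t (a # d)) \<in> \<Inter>F" "\<theta> \<in> F"
    then have "(t (a # c), t (a # d)) \<in> \<theta>" by auto
    with * show "(t (b # c), t (b # d)) \<in> \<theta>"
      using that[OF *(8)] unfolding centralizes_def by blast
  qed
  note least = Least_congruence[OF full_congruence[OF assms(1)],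
      of "centralizes A \<alpha> \<beta>", OF full inter, folded commutator_def]
  show "is_congruence A (commutator A \<alpha> \<beta>)"
    "centralizes A \<alpha> \<beta> (commutator A \<alpha> \<beta>)"
    "\<And>\<delta>. is_congruence A \<delta> \<Longrightarrow> centralizes A \<alpha> \<beta> \<delta> \<Longrightarrow> commutator A \<alpha> \<beta> \<subseteq> \<delta>"
    "commutator A \<alpha> \<beta> = \<Inter>{\<delta>. is_congruence A \<delta> \<and> centralizes A \<alpha> \<beta> \<delta>}"
    using least by blast+
qed

lemma generated_congruence_least:
  assumes "is_algebra A" "X \<subseteq> carrier A \<times> carrier A"
  shows "is_congruence A (generated_congruence A X)"
    "X \<subseteq> generated_congruence A X"
    "\<And>\<theta>. is_congruence A \<theta> \<Longrightarrow> X \<subseteq> \<theta> \<Longrightarrow> generated_congruence A X \<subseteq> \<theta>"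
    "generated_congruence A X = \<Inter>{\<theta>. is_congruence A \<theta> \<and> X \<subseteq> \<theta>}"
  using Least_congruence[OF full_congruence[OF assms(1)], of "\<lambda>\<theta>. X \<subseteq> \<theta>", OF assms(2),
      folded generated_congruence_def] by blast+

lemma congruence_join_least:
  assumes "is_algebra A" "is_congruence A \<alpha>" "is_congruence A \<beta>"
  shows "is_congruence A (congruence_join A \<alpha> \<beta>)"
    "\<alpha> \<subseteq> congruence_join A \<alpha> \<beta>" "\<beta> \<subseteq> congruence_join A \<alpha> \<beta>"
    "\<And>\<theta>. is_congruence A \<theta> \<Longrightarrow> \<alpha> \<subseteq> \<theta> \<Longrightarrow> \<beta> \<subseteq> \<theta> \<Longrightarrow> congruence_join A \<alpha> \<beta> \<subseteq> \<theta>"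
proof -
  have "\<alpha> \<union> \<beta> \<subseteq> carrier A \<times> carrier A"
    using assms(2,3) unfolding is_congruence_def equiv_def by auto
  note gen = generated_congruence_least[OF assms(1) this]
  have "congruence_join A \<alpha> \<beta> = generated_congruence A (\<alpha> \<union> \<beta>)"
    unfolding congruence_join_def generated_congruence_def by simp
  then show "is_congruence A (congruence_join A \<alpha> \<beta>)"
    "\<alpha> \<subseteq> congruence_join A \<alpha> \<beta>" "\<beta> \<subseteq> congruence_join A \<alpha> \<beta>"
    "\<And>\<theta>. is_congruence A \<theta> \<Longrightarrow> \<alpha> \<subseteq> \<theta> \<Longrightarrow> \<beta> \<subseteq> \<theta> \<Longrightarrow> congruence_join A \<alpha> \<beta> \<subseteq> \<theta>"
    using gen(1,2) gen(3) by auto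
qed


section \<open>Groups and Rees matrix semigroups as algebras\<close>

definition group_algebra :: "('g, 'b) monoid_scheme \<Rightarrow> 'g ualgebra" where
  "group_algebra G = \<lparr>carrier = carrier G,
     operations = {(2, \<lambda>xs. xs ! 0 \<otimes>\<^bsub>G\<^esub> xs ! 1), (1, \<lambda>xs. inv\<^bsub>G\<^esub> (xs ! 0)), (0, \<lambda>xs. \<one>\<^bsub>G\<^esub>)}\<rparr>"

fun rees_mult :: "('g, 'b) monoid_scheme \<Rightarrow> ('l \<Rightarrow> 'i \<Rightarrow> 'g)
    \<Rightarrow> 'i \<times> 'g \<times> 'l \<Rightarrow> 'i \<times> 'g \<times> 'l \<Rightarrow> 'i \<times> 'g \<times> 'l" where
  "rees_mult G P (i, g, l) (j, h, m) = (i, g \<otimes>\<^bsub>G\<^esub> P l j \<otimes>\<^bsub>G\<^esub> h, m)"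

definition rees_algebra :: "('g, 'b) monoid_scheme \<Rightarrow> 'i set \<Rightarrow> 'l set \<Rightarrow> ('l \<Rightarrow> 'i \<Rightarrow> 'g)
    \<Rightarrow> ('i \<times> 'g \<times> 'l) ualgebra" where
  "rees_algebra G I \<Lambda> P = \<lparr>carrier = I \<times> carrier G \<times> \<Lambda>,
     operations = {(2, \<lambda>xs. rees_mult G P (xs ! 0) (xs ! 1))}\<rparr>"

lemma is_algebra_group_algebra:
  assumes "group G"
  shows "is_algebra (group_algebra G)"
proof -
  interpret group G by fact
  show ?thesis
    by (auto simp: is_algebra_def group_algebra_def subset_iff)
qed

lemma is_algebra_rees_algebra:
  assumes "group G" "\<And>i l. i \<in> I \<Longrightarrow> l \<in> \<Lambda> \<Longrightarrow> P l i \<in> carrier G"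
  shows "is_algebra (rees_algebra G I \<Lambda> P)"
proof -
  interpret group G by fact
  have closed: "rees_mult G P x y \<in> I \<times> carrier G \<times> \<Lambda>"
    if "x \<in> I \<times> carrier G \<times> \<Lambda>" "y \<in> I \<times> carrier G \<times> \<Lambda>" for x y
    using that assms(2) by auto
  have "rees_mult G P (xs ! 0) (xs ! 1) \<in> I \<times> carrier G \<times> \<Lambda>"
    if "length xs = 2" "set xs \<subseteq> I \<times> carrier G \<times> \<Lambda>" for xs
  proof -
    have "xs ! 0 \<in> set xs" "xs ! 1 \<in> set xs" using that(1) by simp_all
    then show ?thesis using that(2) closed by blast
  qed
  then show ?thesis
    unfolding is_algebra_def rees_algebra_def by simp
qed


section \<open>Components of congruences, linked triples\<close>

definition component_I :: "('g, 'b) monoid_scheme \<Rightarrow> 'i set \<Rightarrow> 'l set \<Rightarrow> ('l \<Rightarrow> 'i \<Rightarrow> 'g)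
    \<Rightarrow> ('i \<times> 'g \<times> 'l) rel \<Rightarrow> 'i rel" where
  "component_I G I \<Lambda> P \<rho> = {(i, j) \<in> I \<times> I.
     \<forall>l\<in>\<Lambda>. ((i, inv\<^bsub>G\<^esub> (P l i), l), (j, inv\<^bsub>G\<^esub> (P l j), l)) \<in> \<rho>}"

definition component_Lambda :: "('g, 'b) monoid_scheme \<Rightarrow> 'i set \<Rightarrow> 'l set \<Rightarrow> ('l \<Rightarrow> 'i \<Rightarrow> 'g)
    \<Rightarrow> ('i \<times> 'g \<times> 'l) rel \<Rightarrow> 'l rel" where
  "component_Lambda G I \<Lambda> P \<rho> = {(l, m) \<in> \<Lambda> \<times> \<Lambda>.
     \<forall>i\<in>I. ((i, inv\<^bsub>G\<^esub> (P l i), l), (i, inv\<^bsub>G\<^esub> (P m i), m)) \<in> \<rho>}"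

(* i1 and l1 are the distinguished elements (both called 1) of I and \<Lambda>. *)
definition component_G :: "('g, 'b) monoid_scheme \<Rightarrow> 'i \<Rightarrow> 'l
    \<Rightarrow> ('i \<times> 'g \<times> 'l) rel \<Rightarrow> 'g rel" where
  "component_G G i1 l1 \<rho> = {(a, b) \<in> carrier G \<times> carrier G. ((i1, a, l1), (i1, b, l1)) \<in> \<rho>}"

definition linked_triple :: "('g, 'b) monoid_scheme \<Rightarrow> 'i set \<Rightarrow> 'l set \<Rightarrow> ('l \<Rightarrow> 'i \<Rightarrow> 'g)
    \<Rightarrow> 'i rel \<Rightarrow> 'g rel \<Rightarrow> 'l rel \<Rightarrow> bool" where
  "linked_triple G I \<Lambda> P \<epsilon> \<tau> \<eta> \<longleftrightarrow>
     equiv I \<epsilon> \<and> is_congruence (group_algebra G) \<tau> \<and> equiv \<Lambda> \<eta> \<and>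
     (\<forall>i\<in>I. \<forall>j\<in>I. \<forall>l\<in>\<Lambda>. \<forall>m\<in>\<Lambda>. (i, j) \<in> \<epsilon> \<or> (l, m) \<in> \<eta> \<longrightarrow>
        (P l i \<otimes>\<^bsub>G\<^esub> inv\<^bsub>G\<^esub> (P m i) \<otimes>\<^bsub>G\<^esub> P m j \<otimes>\<^bsub>G\<^esub> inv\<^bsub>G\<^esub> (P l j), \<one>\<^bsub>G\<^esub>) \<in> \<tau>)"

definition Theta :: "('g, 'b) monoid_scheme \<Rightarrow> 'i set \<Rightarrow> 'l set \<Rightarrow> ('l \<Rightarrow> 'i \<Rightarrow> 'g)
    \<Rightarrow> ('i \<times> 'g \<times> 'l) rel \<Rightarrow> ('i \<times> 'g \<times> 'l) rel \<Rightarrow> 'g rel" where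
  "Theta G I \<Lambda> P \<rho> \<sigma> = generated_congruence (group_algebra G)
     {(P m i \<otimes>\<^bsub>G\<^esub> inv\<^bsub>G\<^esub> (P l i), P m j \<otimes>\<^bsub>G\<^esub> inv\<^bsub>G\<^esub> (P l j)) | i j l m.
        i \<in> I \<and> j \<in> I \<and> l \<in> \<Lambda> \<and> m \<in> \<Lambda> \<and>
        ((i, j) \<in> component_I G I \<Lambda> P \<rho> \<and> (l, m) \<in> component_Lambda G I \<Lambda> P \<sigma> \<or>
         (l, m) \<in> component_Lambda G I \<Lambda> P \<rho> \<and> (i, j) \<in> component_I G I \<Lambda> P \<sigma>)}"

end

theory Submission
  imports Defs
begin

text \<open>
  Because of the normalization, multiplying by \<open>(1, e, 1)\<close> on both sides, and by suitable elements
  \<open>(1, g, 1)\<close> on one side, splits every congruence of the semigroup into coordinates: two triples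
  are related iff their entries are related by the three components
  (\<open>related_iff_components\<close>). So everything reduces to coordinatewise bookkeeping,
  in which the sandwich matrix is the only link between the coordinates.

  In a group, centrality is commutation of normal subgroups: \<open>\<alpha>\<close> centralizes \<open>\<beta>\<close> modulo \<open>\<delta>\<close> iff
  each element of the \<open>\<alpha>\<close>-class of the identity commutes modulo \<open>\<delta>\<close> with each element of the
  \<open>\<beta>\<close>-class of the identity (\<open>centralizes_group_iff\<close>). This condition can be read off from the
  single term \<open>y x y'\<close>, which has no inverses and is therefore also a semigroup term.

  Lower bound: if \<open>\<rho>\<close> centralizes \<open>\<sigma>\<close> modulo \<open>\<delta>\<close>, then the term \<open>y x y'\<close> evaluated in the copy of the
  group at \<open>(1, 1)\<close> gives \<open>[\<rho>\<^sub>G, \<sigma>\<^sub>G] \<subseteq> \<delta>\<^sub>G\<close>, and evaluated at triples whose products meet the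
  sandwich matrix it gives the generators of \<open>\<Theta>\<close>.

  Upper bound: let \<open>\<tau>\<close> be the join in the theorem. It has to be shown that \<open>\<rho>\<close> centralizes \<open>\<sigma>\<close> modulo
  the congruence that relates \<open>(i, g, \<lambda>)\<close> to \<open>(i, h, \<lambda>)\<close> for \<open>g \<tau> h\<close>. For a term \<open>t\<close>, the four
  values \<open>t(a, c)\<close>, \<open>t(a, d)\<close>, \<open>t(b, c)\<close>, \<open>t(b, d)\<close> form a square. The outer coordinates of a
  product come from its first and its last factor, so in these coordinates the square is constant
  along its rows or along its columns. In the group coordinate the squares \<open>(x, y, z, w)\<close> that occur
  satisfy \<open>z x\<^sup>-\<^sup>1 \<tau> w y\<^sup>-\<^sup>1\<close>: such squares are closed under multiplication because \<open>\<rho>\<^sub>G\<close> and \<open>\<sigma>\<^sub>G\<close>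
  commute modulo \<open>\<tau>\<close>, and the entries of the sandwich matrix that enter a product form such a square
  because \<open>\<tau>\<close> contains \<open>\<Theta>\<close> (\<open>central_square_sandwich_matrix\<close>). If \<open>x \<tau> y\<close>, such a square gives \<open>z \<tau> w\<close>.
\<close>

section \<open>Centrality in arbitrary algebras\<close>

text \<open>
  The four values of a term in the definition of centrality range over the subalgebra of the fourth
  power generated by the squares \<open>(a, a, b, b)\<close> and \<open>(c, d, c, d)\<close>. Any invariant relation \<open>Q\<close>
  containing these generators contains all of them, so an induction over terms is replaced by
  a check of the basic operations.
\<close>

lemma centralizes_if_invariant_relation:
  assumes preserved: "\<And>n f xs ys zs ws.
      \<lbrakk>(n, f) \<in> operations A; length xs = n; length ys = n; length zs = n; length ws = n;
       \<And>i. i < n \<Longrightarrow> Q (xs ! i) (ys ! i) (zs ! i) (ws ! i)\<rbrakk>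
      \<Longrightarrow> Q (f xs) (f ys) (f zs) (f ws)"
    and rows: "\<And>a b. (a, b) \<in> \<alpha> \<Longrightarrow> Q a a b b"
    and columns: "\<And>c d. (c, d) \<in> \<beta> \<Longrightarrow> Q c d c d"
    and transfer: "\<And>x y z w. \<lbrakk>Q x y z w; (x, y) \<in> \<delta>\<rbrakk> \<Longrightarrow> (z, w) \<in> \<delta>"
  shows "centralizes A \<alpha> \<beta> \<delta>"
  unfolding centralizes_def
proof (intro allI impI, elim conjE)
  fix n t a b and c d :: "'a list"
  assume t: "term_function A (Suc n) t" and ab: "(a, b) \<in> \<alpha>"
    and len: "length c = n" "length d = n" and cd: "\<forall>i<n. (c ! i, d ! i) \<in> \<beta>"
    and \<delta>: "(t (a # c), t (a # d)) \<in> \<delta>"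
  from t have "Q (t (a # c)) (t (a # d)) (t (b # c)) (t (b # d))"
  proof induction
    case (projection i)
    then show ?case using rows[OF ab] columns cd by (cases i) auto
  next
    case (composition m f ts)
    show ?case by (rule preserved[OF composition(1)]) (use composition in auto)
  qed
  then show "(t (b # c), t (b # d)) \<in> \<delta>" using \<delta> by (rule transfer)
qed

text \<open>
  The one instance of the term condition from which all lower bounds are derived: the term \<open>y x y'\<close>
  for a binary operation.
\<close>

lemma centralizes_sandwich:
  assumes C: "centralizes A \<alpha> \<beta> \<delta>" and f: "(2, f) \<in> operations A"
    and ab: "(a, b) \<in> \<alpha>" and cd: "(c, d) \<in> \<beta>" "(c', d') \<in> \<beta>"
    and a: "(f [f [c, a], c'], f [f [d, a], d']) \<in> \<delta>"
  shows "(f [f [c, b], c'], f [f [d, b], d']) \<in> \<delta>"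
proof -
  define s where "s xs = f (map (\<lambda>t. t xs) [\<lambda>xs. xs ! 1, \<lambda>xs. xs ! 0])" for xs
  define t where "t xs = f (map (\<lambda>t. t xs) [s, \<lambda>xs. xs ! 2])" for xs
  have "term_function A (Suc 2) s"
    unfolding s_def[abs_def]
    by (rule term_function.composition[OF f]) (auto intro!: term_function.projection)
  then have "term_function A (Suc 2) t"
    unfolding t_def[abs_def]
    by (intro term_function.composition[OF f]) (auto intro!: term_function.projection)
  moreover have "\<forall>i<2. ([c, c'] ! i, [d, d'] ! i) \<in> \<beta>"
    using cd by (auto simp: less_2_cases_iff)
  moreover have "(t (a # [c, c']), t (a # [d, d'])) \<in> \<delta>"
    using a by (simp add: t_def s_def)
  ultimately have "(t (b # [c, c']), t (b # [d, d'])) \<in> \<delta>"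
    using C ab unfolding centralizes_def
    by (metis length_Cons list.size(3) numeral_2_eq_2 one_le_numeral)
  then show ?thesis by (simp add: t_def s_def)
qed

section \<open>Centrality in groups\<close>

context group
begin

lemma inv_mult_cancel [simp]:
  assumes "a \<in> carrier G" "b \<in> carrier G"
  shows "inv a \<otimes> (a \<otimes> b) = b" "a \<otimes> (inv a \<otimes> b) = b"
  using assms by (simp_all add: m_assoc[symmetric])

text \<open>
  From \<open>a \<theta> b\<close> one gets \<open>a\<^sup>-\<^sup>1 b b\<^sup>-\<^sup>1 \<theta> a\<^sup>-\<^sup>1 a b\<^sup>-\<^sup>1\<close>, so compatibility with inverses is automatic.
  This is what makes the group component of a semigroup congruence a group congruence.
\<close>

lemma group_congruence_if_mult:
  assumes eq: "equiv (carrier G) \<theta>"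
    and mult: "\<And>a b c d. \<lbrakk>(a, b) \<in> \<theta>; (c, d) \<in> \<theta>\<rbrakk> \<Longrightarrow> (a \<otimes> c, b \<otimes> d) \<in> \<theta>"
  shows "is_congruence (group_algebra G) \<theta>"
proof -
  have refl: "(x, x) \<in> \<theta>" if "x \<in> carrier G" for x
    using eq that by (auto simp: equiv_def refl_on_def)
  have "(inv a, inv b) \<in> \<theta>" if ab: "(a, b) \<in> \<theta>" for a b
  proof -
    have c: "a \<in> carrier G" "b \<in> carrier G" using eq ab by (auto simp: equiv_def)
    have "(inv a \<otimes> b \<otimes> inv b, inv a \<otimes> a \<otimes> inv b) \<in> \<theta>"
      using eq ab c by (intro mult refl) (auto simp: equiv_def sym_def)
    then show ?thesis using c by (simp add: m_assoc)
  qed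
  then show ?thesis
    using eq refl mult
    by (auto simp: is_congruence_def group_algebra_def list_all2_conv_all_nth)
qed

lemma group_congruenceD:
  assumes "is_congruence (group_algebra G) \<theta>"
  shows "\<And>a b. (a, b) \<in> \<theta> \<Longrightarrow> a \<in> carrier G" "\<And>a b. (a, b) \<in> \<theta> \<Longrightarrow> b \<in> carrier G"
    "\<And>a. a \<in> carrier G \<Longrightarrow> (a, a) \<in> \<theta>"
    "\<And>a b. (a, b) \<in> \<theta> \<Longrightarrow> (b, a) \<in> \<theta>"
    "\<And>a b c. (a, b) \<in> \<theta> \<Longrightarrow> (b, c) \<in> \<theta> \<Longrightarrow> (a, c) \<in> \<theta>"
    "\<And>a b c d. (a, b) \<in> \<theta> \<Longrightarrow> (c, d) \<in> \<theta> \<Longrightarrow> (a \<otimes> c, b \<otimes> d) \<in> \<theta>"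
    "\<And>a b. (a, b) \<in> \<theta> \<Longrightarrow> (inv a, inv b) \<in> \<theta>"
proof -
  have eq: "equiv (carrier G) \<theta>"
    and mult: "\<And>xs ys. length xs = 2 \<Longrightarrow> list_all2 (\<lambda>x y. (x, y) \<in> \<theta>) xs ys
        \<Longrightarrow> (xs ! 0 \<otimes> xs ! 1, ys ! 0 \<otimes> ys ! 1) \<in> \<theta>"
    and inv: "\<And>xs ys. length xs = 1 \<Longrightarrow> list_all2 (\<lambda>x y. (x, y) \<in> \<theta>) xs ys
        \<Longrightarrow> (inv (xs ! 0), inv (ys ! 0)) \<in> \<theta>"
    using assms by (auto simp: is_congruence_def group_algebra_def)
  show "\<And>a b. (a, b) \<in> \<theta> \<Longrightarrow> a \<in> carrier G" "\<And>a b. (a, b) \<in> \<theta> \<Longrightarrow> b \<in> carrier G"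
    "\<And>a. a \<in> carrier G \<Longrightarrow> (a, a) \<in> \<theta>"
    "\<And>a b. (a, b) \<in> \<theta> \<Longrightarrow> (b, a) \<in> \<theta>"
    "\<And>a b c. (a, b) \<in> \<theta> \<Longrightarrow> (b, c) \<in> \<theta> \<Longrightarrow> (a, c) \<in> \<theta>"
    using eq by (auto simp: equiv_def refl_on_def elim: symE transE)
  show "(a \<otimes> c, b \<otimes> d) \<in> \<theta>" if "(a, b) \<in> \<theta>" "(c, d) \<in> \<theta>" for a b c d
    using mult[of "[a, c]" "[b, d]"] that by simp
  show "(inv a, inv b) \<in> \<theta>" if "(a, b) \<in> \<theta>" for a b
    using inv[of "[a]" "[b]"] that by simp
qed

lemma group_congruence_right_quotient_iff:
  assumes \<theta>: "is_congruence (group_algebra G) \<theta>" and ab: "a \<in> carrier G" "b \<in> carrier G"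
  shows "(a \<otimes> inv b, \<one>) \<in> \<theta> \<longleftrightarrow> (a, b) \<in> \<theta>"
proof
  note D = group_congruenceD[OF \<theta>]
  show "(a, b) \<in> \<theta>" if "(a \<otimes> inv b, \<one>) \<in> \<theta>"
    using D(6)[OF that D(3)[OF ab(2)]] ab by (simp add: m_assoc)
  show "(a \<otimes> inv b, \<one>) \<in> \<theta>" if "(a, b) \<in> \<theta>"
    using D(6)[OF that D(3)[OF inv_closed[OF ab(2)]]] ab by simp
qed

text \<open>
  The elements congruent to \<open>\<one>\<close> form the normal subgroups of \<open>\<alpha>\<close> and \<open>\<beta>\<close>; the condition says that
  the commutator subgroup of these two lies in the normal subgroup of \<open>\<delta>\<close>.
\<close>

definition commute_modulo :: "'a rel \<Rightarrow> 'a rel \<Rightarrow> 'a rel \<Rightarrow> bool" where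
  "commute_modulo \<alpha> \<beta> \<delta> \<longleftrightarrow>
     (\<forall>x y. (x, \<one>) \<in> \<alpha> \<longrightarrow> (y, \<one>) \<in> \<beta> \<longrightarrow> (y \<otimes> x, x \<otimes> y) \<in> \<delta>)"

text \<open>
  The rows \<open>(x, y)\<close> and \<open>(z, w)\<close> of a square are \<open>\<beta>\<close>-related, its columns \<open>(x, z)\<close> and \<open>(y, w)\<close>
  are \<open>\<alpha>\<close>-related, and the passage from the first row to the second is left multiplication by the
  same element modulo \<open>\<delta>\<close>. When \<open>\<alpha>\<close> and \<open>\<beta>\<close> commute modulo \<open>\<delta>\<close>, right multiplication would give
  the same relation; left multiplication is chosen to match the shape of the generators of \<open>\<Theta>\<close>.
\<close>

definition central_square :: "'a rel \<Rightarrow> 'a rel \<Rightarrow> 'a rel \<Rightarrow> 'a \<Rightarrow> 'a \<Rightarrow> 'a \<Rightarrow> 'a \<Rightarrow> bool" where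
  "central_square \<alpha> \<beta> \<delta> x y z w \<longleftrightarrow>
     (x, y) \<in> \<beta> \<and> (z, w) \<in> \<beta> \<and> (x, z) \<in> \<alpha> \<and> (y, w) \<in> \<alpha> \<and>
     (z \<otimes> inv x, w \<otimes> inv y) \<in> \<delta>"

text \<open>
  With \<open>c = y\<close>, \<open>c' = y\<^sup>-\<^sup>1\<close> and \<open>d = d' = a = \<one>\<close> both products for \<open>a\<close> are \<open>\<one>\<close>, so the hypothesis,
  applied with \<open>b = x\<close>, says that conjugation by \<open>y\<close> fixes \<open>x\<close> modulo \<open>\<delta>\<close>.
\<close>

lemma commute_moduloI_sandwich:
  assumes \<alpha>: "is_congruence (group_algebra G) \<alpha>" and \<beta>: "is_congruence (group_algebra G) \<beta>"
    and \<delta>: "is_congruence (group_algebra G) \<delta>"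
    and sandwich: "\<And>a b c d c' d'. \<lbrakk>(a, b) \<in> \<alpha>; (c, d) \<in> \<beta>; (c', d') \<in> \<beta>;
        (c \<otimes> a \<otimes> c', d \<otimes> a \<otimes> d') \<in> \<delta>\<rbrakk> \<Longrightarrow> (c \<otimes> b \<otimes> c', d \<otimes> b \<otimes> d') \<in> \<delta>"
  shows "commute_modulo \<alpha> \<beta> \<delta>"
  unfolding commute_modulo_def
proof (intro allI impI)
  note D\<alpha> = group_congruenceD[OF \<alpha>] and D\<beta> = group_congruenceD[OF \<beta>]
    and D\<delta> = group_congruenceD[OF \<delta>]
  fix x y assume x: "(x, \<one>) \<in> \<alpha>" and y: "(y, \<one>) \<in> \<beta>"
  have c: "x \<in> carrier G" "y \<in> carrier G" using x y D\<alpha>(1) D\<beta>(1) by blast+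
  have "(inv y, \<one>) \<in> \<beta>" using D\<beta>(7)[OF y] by simp
  then have "(y \<otimes> x \<otimes> inv y, \<one> \<otimes> x \<otimes> \<one>) \<in> \<delta>"
    using c by (intro sandwich[OF D\<alpha>(4)[OF x] y]) (auto intro: D\<delta>(3))
  from D\<delta>(6)[OF this D\<delta>(3)[OF c(2)]] show "(y \<otimes> x, x \<otimes> y) \<in> \<delta>"
    using c by (simp add: m_assoc)
qed

context
  fixes \<alpha> \<beta> \<delta> :: "'a rel"
  assumes \<alpha>: "is_congruence (group_algebra G) \<alpha>" and \<beta>: "is_congruence (group_algebra G) \<beta>"
    and \<delta>: "is_congruence (group_algebra G) \<delta>"
    and commute: "commute_modulo \<alpha> \<beta> \<delta>"
begin

text \<open>
  Conjugation by \<open>g\<close> is conjugation by \<open>h\<^sup>-\<^sup>1 g\<close> followed by conjugation by \<open>h\<close>, and the first of these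
  fixes \<open>u\<close> modulo \<open>\<delta>\<close>, because \<open>h\<^sup>-\<^sup>1 g\<close> is \<open>\<beta>\<close>-related to \<open>\<one>\<close>.
\<close>

lemma conjugate_modulo:
  assumes g: "(g, h) \<in> \<beta>" and u: "(u, \<one>) \<in> \<alpha>" and uv: "(u, v) \<in> \<delta>"
  shows "(g \<otimes> u \<otimes> inv g, h \<otimes> v \<otimes> inv h) \<in> \<delta>"
proof -
  note D\<alpha> = group_congruenceD[OF \<alpha>] and D\<beta> = group_congruenceD[OF \<beta>]
    and D\<delta> = group_congruenceD[OF \<delta>]
  have c: "g \<in> carrier G" "h \<in> carrier G" "u \<in> carrier G" "v \<in> carrier G"
    using D\<beta>(1,2)[OF g] D\<alpha>(1)[OF u] D\<delta>(2)[OF uv] by auto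
  let ?m = "inv h \<otimes> g"
  have "(?m, \<one>) \<in> \<beta>" using D\<beta>(6)[OF D\<beta>(3)[of "inv h"] g] c by simp
  then have "(?m \<otimes> u, u \<otimes> ?m) \<in> \<delta>" using commute u by (auto simp: commute_modulo_def)
  from D\<delta>(6)[OF D\<delta>(6)[OF D\<delta>(3)[of h] this] D\<delta>(3)[of "inv g"]]
  have "(g \<otimes> u \<otimes> inv g, h \<otimes> u \<otimes> inv h) \<in> \<delta>" using c by (simp add: m_assoc)
  moreover have "(h \<otimes> u \<otimes> inv h, h \<otimes> v \<otimes> inv h) \<in> \<delta>"
    using c uv by (intro D\<delta>(6) D\<delta>(3)) auto
  ultimately show ?thesis by (rule D\<delta>(5))
qed

text \<open>
  The quotient of the product square is \<open>z z' (x x')\<^sup>-\<^sup>1 = (z x\<^sup>-\<^sup>1) (x (z' x'\<^sup>-\<^sup>1) x\<^sup>-\<^sup>1)\<close>. Its second factor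
  is a conjugate of an element that is \<open>\<alpha>\<close>-related to \<open>\<one>\<close>, so replacing the conjugating element \<open>x\<close>
  by the \<open>\<beta>\<close>-related element \<open>y\<close> does not change it modulo \<open>\<delta>\<close>.
\<close>

lemma central_square_mult:
  assumes 1: "central_square \<alpha> \<beta> \<delta> x y z w" and 2: "central_square \<alpha> \<beta> \<delta> x' y' z' w'"
  shows "central_square \<alpha> \<beta> \<delta> (x \<otimes> x') (y \<otimes> y') (z \<otimes> z') (w \<otimes> w')"
proof -
  note D\<alpha> = group_congruenceD[OF \<alpha>] and D\<beta> = group_congruenceD[OF \<beta>]
    and D\<delta> = group_congruenceD[OF \<delta>]
  have c: "x \<in> carrier G" "y \<in> carrier G" "z \<in> carrier G" "w \<in> carrier G"
    "x' \<in> carrier G" "y' \<in> carrier G" "z' \<in> carrier G" "w' \<in> carrier G"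
    using 1 2 D\<beta>(1,2) unfolding central_square_def by blast+
  have "(z' \<otimes> inv x', \<one>) \<in> \<alpha>"
    using 2 c D\<alpha>(4) by (auto simp: central_square_def group_congruence_right_quotient_iff[OF \<alpha>])
  then have "(x \<otimes> (z' \<otimes> inv x') \<otimes> inv x, y \<otimes> (w' \<otimes> inv y') \<otimes> inv y) \<in> \<delta>"
    using 1 2 by (intro conjugate_modulo) (auto simp: central_square_def)
  then have "(z \<otimes> inv x \<otimes> (x \<otimes> (z' \<otimes> inv x') \<otimes> inv x),
      w \<otimes> inv y \<otimes> (y \<otimes> (w' \<otimes> inv y') \<otimes> inv y)) \<in> \<delta>"
    using 1 by (intro D\<delta>(6)[of "z \<otimes> inv x"]) (auto simp: central_square_def)
  then have "(z \<otimes> z' \<otimes> inv (x \<otimes> x'), w \<otimes> w' \<otimes> inv (y \<otimes> y')) \<in> \<delta>"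
    using c by (simp add: m_assoc inv_mult_group)
  then show ?thesis
    using 1 2 D\<alpha>(6) D\<beta>(6) by (simp add: central_square_def)
qed

text \<open>
  Inverting turns the left quotient \<open>z x\<^sup>-\<^sup>1\<close> into the quotient \<open>z\<^sup>-\<^sup>1 x = z\<^sup>-\<^sup>1 (x z\<^sup>-\<^sup>1) z\<close> on the other
  side; conjugation by the \<open>\<beta>\<close>-related elements \<open>z\<^sup>-\<^sup>1\<close> and \<open>w\<^sup>-\<^sup>1\<close> brings it back.
\<close>

lemma central_square_inv:
  assumes sq: "central_square \<alpha> \<beta> \<delta> x y z w"
  shows "central_square \<alpha> \<beta> \<delta> (inv x) (inv y) (inv z) (inv w)"
proof -
  note D\<alpha> = group_congruenceD[OF \<alpha>] and D\<beta> = group_congruenceD[OF \<beta>]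
    and D\<delta> = group_congruenceD[OF \<delta>]
  have c: "x \<in> carrier G" "y \<in> carrier G" "z \<in> carrier G" "w \<in> carrier G"
    using sq D\<beta>(1,2) unfolding central_square_def by blast+
  have "(inv (z \<otimes> inv x), inv (w \<otimes> inv y)) \<in> \<delta>"
    using sq by (intro D\<delta>(7)) (auto simp: central_square_def)
  then have "(x \<otimes> inv z, y \<otimes> inv w) \<in> \<delta>" using c by (simp add: inv_mult_group)
  moreover have "(x \<otimes> inv z, \<one>) \<in> \<alpha>"
    using sq c by (simp add: central_square_def group_congruence_right_quotient_iff[OF \<alpha>])
  ultimately have "(inv z \<otimes> (x \<otimes> inv z) \<otimes> inv (inv z),
      inv w \<otimes> (y \<otimes> inv w) \<otimes> inv (inv w)) \<in> \<delta>"
    using sq by (intro conjugate_modulo D\<beta>(7)) (auto simp: central_square_def)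
  then have "(inv z \<otimes> inv (inv x), inv w \<otimes> inv (inv y)) \<in> \<delta>"
    using c by (simp add: m_assoc)
  then show ?thesis
    using sq D\<alpha>(7) D\<beta>(7) by (simp add: central_square_def)
qed

lemma central_square_rows: "(a, b) \<in> \<alpha> \<Longrightarrow> central_square \<alpha> \<beta> \<delta> a a b b"
  using group_congruenceD(1,2)[OF \<alpha>, of a b] group_congruenceD(3)[OF \<beta>] group_congruenceD(3)[OF \<delta>]
  by (simp add: central_square_def)

lemma central_square_columns: "(c, d) \<in> \<beta> \<Longrightarrow> central_square \<alpha> \<beta> \<delta> c d c d"
  using group_congruenceD(1,2)[OF \<beta>, of c d] group_congruenceD(3)[OF \<alpha>] group_congruenceD(3)[OF \<delta>]
  by (simp add: central_square_def)

lemma central_square_transfer: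
  assumes sq: "central_square \<alpha> \<beta> \<delta> x y z w" and xy: "(x, y) \<in> \<delta>"
  shows "(z, w) \<in> \<delta>"
proof -
  have "x \<in> carrier G" "y \<in> carrier G" "z \<in> carrier G" "w \<in> carrier G"
    using sq group_congruenceD(1,2)[OF \<beta>] unfolding central_square_def by blast+
  moreover have "(z \<otimes> inv x \<otimes> x, w \<otimes> inv y \<otimes> y) \<in> \<delta>"
    using sq xy by (intro group_congruenceD(6)[OF \<delta>, of "z \<otimes> inv x"]) (auto simp: central_square_def)
  ultimately show ?thesis by (simp add: m_assoc)
qed

lemma centralizes_if_commute_modulo: "centralizes (group_algebra G) \<alpha> \<beta> \<delta>"
proof (rule centralizes_if_invariant_relation[where Q = "central_square \<alpha> \<beta> \<delta>"])
  fix n f xs ys zs ws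
  assume op: "(n, f) \<in> operations (group_algebra G)"
    and len: "length xs = n" "length ys = n" "length zs = n" "length ws = n"
    and sq: "\<And>i. i < n \<Longrightarrow> central_square \<alpha> \<beta> \<delta> (xs ! i) (ys ! i) (zs ! i) (ws ! i)"
  have "(\<one>, \<one>) \<in> \<alpha>" using group_congruenceD(3)[OF \<alpha>] by simp
  then have "central_square \<alpha> \<beta> \<delta> \<one> \<one> \<one> \<one>" by (rule central_square_rows)
  then show "central_square \<alpha> \<beta> \<delta> (f xs) (f ys) (f zs) (f ws)"
    using op sq by (auto simp: group_algebra_def intro: central_square_mult central_square_inv)
qed (auto intro: central_square_rows central_square_columns central_square_transfer)

end

text \<open>
  The term \<open>y x y'\<close> already forces commutation, and commutation makes the central squares
  an invariant relation.
\<close>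

theorem centralizes_group_iff:
  assumes "is_congruence (group_algebra G) \<alpha>" "is_congruence (group_algebra G) \<beta>"
    "is_congruence (group_algebra G) \<delta>"
  shows "centralizes (group_algebra G) \<alpha> \<beta> \<delta> \<longleftrightarrow> commute_modulo \<alpha> \<beta> \<delta>"
proof
  assume C: "centralizes (group_algebra G) \<alpha> \<beta> \<delta>"
  have op: "(2, \<lambda>xs. xs ! 0 \<otimes> xs ! 1) \<in> operations (group_algebra G)"
    by (simp add: group_algebra_def)
  show "commute_modulo \<alpha> \<beta> \<delta>"
    using centralizes_sandwich[OF C op] by (intro commute_moduloI_sandwich[OF assms]) auto
next
  assume "commute_modulo \<alpha> \<beta> \<delta>"
  then show "centralizes (group_algebra G) \<alpha> \<beta> \<delta>"
    by (rule centralizes_if_commute_modulo[OF assms])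
qed

end

section \<open>Congruences of a normalized Rees matrix semigroup\<close>

locale normalized_rees = group G for G (structure) +
  fixes I :: "'i set" and \<Lambda> :: "'l set" and i1 :: 'i and l1 :: 'l and P :: "'l \<Rightarrow> 'i \<Rightarrow> 'a"
  assumes i1 [simp]: "i1 \<in> I" and l1 [simp]: "l1 \<in> \<Lambda>"
    and P_closed [simp]: "\<And>l i. l \<in> \<Lambda> \<Longrightarrow> i \<in> I \<Longrightarrow> P l i \<in> carrier G"
    and P_row [simp]: "\<And>i. i \<in> I \<Longrightarrow> P l1 i = \<one>"
    and P_column [simp]: "\<And>l. l \<in> \<Lambda> \<Longrightarrow> P l i1 = \<one>"
begin

abbreviation "S \<equiv> rees_algebra G I \<Lambda> P"
abbreviation "comp_I \<equiv> component_I G I \<Lambda> P"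
abbreviation "comp_G \<equiv> component_G G i1 l1"
abbreviation "comp_\<Lambda> \<equiv> component_Lambda G I \<Lambda> P"

lemma rees_congruence_iff:
  "is_congruence S \<theta> \<longleftrightarrow> equiv (I \<times> carrier G \<times> \<Lambda>) \<theta> \<and>
     (\<forall>x y z w. (x, y) \<in> \<theta> \<longrightarrow> (z, w) \<in> \<theta> \<longrightarrow> (rees_mult G P x z, rees_mult G P y w) \<in> \<theta>)"
    (is "?L \<longleftrightarrow> ?R")
proof
  assume L: ?L
  then have eq: "equiv (I \<times> carrier G \<times> \<Lambda>) \<theta>"
    and mult: "\<And>xs ys. length xs = 2 \<Longrightarrow> list_all2 (\<lambda>x y. (x, y) \<in> \<theta>) xs ys
        \<Longrightarrow> (rees_mult G P (xs ! 0) (xs ! 1), rees_mult G P (ys ! 0) (ys ! 1)) \<in> \<theta>"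
    by (auto simp: is_congruence_def rees_algebra_def)
  have "(rees_mult G P x z, rees_mult G P y w) \<in> \<theta>" if "(x, y) \<in> \<theta>" "(z, w) \<in> \<theta>" for x y z w
    using mult[of "[x, z]" "[y, w]"] that by simp
  with eq show ?R by blast
next
  assume ?R
  then show ?L
    by (simp add: is_congruence_def rees_algebra_def list_all2_conv_all_nth del: split_paired_All)
qed

context
  fixes \<rho> :: "('i \<times> 'a \<times> 'l) rel"
  assumes \<rho>: "is_congruence S \<rho>"
begin

lemma rees_congruenceD:
  shows "\<And>i g l j h m. ((i, g, l), (j, h, m)) \<in> \<rho> \<Longrightarrow>
      i \<in> I \<and> g \<in> carrier G \<and> l \<in> \<Lambda> \<and> j \<in> I \<and> h \<in> carrier G \<and> m \<in> \<Lambda>"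
    "\<And>i g l. \<lbrakk>i \<in> I; g \<in> carrier G; l \<in> \<Lambda>\<rbrakk> \<Longrightarrow> ((i, g, l), (i, g, l)) \<in> \<rho>"
    "\<And>x y. (x, y) \<in> \<rho> \<Longrightarrow> (y, x) \<in> \<rho>"
    "\<And>x y z. (x, y) \<in> \<rho> \<Longrightarrow> (y, z) \<in> \<rho> \<Longrightarrow> (x, z) \<in> \<rho>"
    "\<And>x y z w. (x, y) \<in> \<rho> \<Longrightarrow> (z, w) \<in> \<rho> \<Longrightarrow> (rees_mult G P x z, rees_mult G P y w) \<in> \<rho>"
proof -
  have eq: "equiv (I \<times> carrier G \<times> \<Lambda>) \<rho>" using \<rho> rees_congruence_iff by blast
  show "\<And>i g l j h m. ((i, g, l), (j, h, m)) \<in> \<rho> \<Longrightarrow>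
      i \<in> I \<and> g \<in> carrier G \<and> l \<in> \<Lambda> \<and> j \<in> I \<and> h \<in> carrier G \<and> m \<in> \<Lambda>"
    "\<And>i g l. \<lbrakk>i \<in> I; g \<in> carrier G; l \<in> \<Lambda>\<rbrakk> \<Longrightarrow> ((i, g, l), (i, g, l)) \<in> \<rho>"
    using eq by (auto simp: equiv_def refl_on_def)
  show "\<And>x y. (x, y) \<in> \<rho> \<Longrightarrow> (y, x) \<in> \<rho>"
    "\<And>x y z. (x, y) \<in> \<rho> \<Longrightarrow> (y, z) \<in> \<rho> \<Longrightarrow> (x, z) \<in> \<rho>"
    using eq unfolding equiv_def by (meson symE transE)+
  show "\<And>x y z w. (x, y) \<in> \<rho> \<Longrightarrow> (z, w) \<in> \<rho> \<Longrightarrow> (rees_mult G P x z, rees_mult G P y w) \<in> \<rho>"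
    using \<rho> rees_congruence_iff by blast
qed

lemma component_G_congruence: "is_congruence (group_algebra G) (comp_G \<rho>)"
proof (rule group_congruence_if_mult)
  show "equiv (carrier G) (comp_G \<rho>)"
  proof (rule equivI)
    show "refl_on (carrier G) (comp_G \<rho>)"
      by (auto simp: component_G_def refl_on_def rees_congruenceD(2))
    show "sym (comp_G \<rho>)" by (auto simp: component_G_def intro: symI rees_congruenceD(3))
    show "trans (comp_G \<rho>)"
      by (rule transI) (auto simp: component_G_def intro: rees_congruenceD(4))
  qed (auto simp: component_G_def)
  show "(a \<otimes> c, b \<otimes> d) \<in> comp_G \<rho>" if "(a, b) \<in> comp_G \<rho>" "(c, d) \<in> comp_G \<rho>" for a b c d
    using rees_congruenceD(5)[of "(i1, a, l1)" "(i1, b, l1)" "(i1, c, l1)" "(i1, d, l1)"] that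
    by (auto simp: component_G_def)
qed

text \<open>
  Multiplication by \<open>(1, e, 1)\<close> on both sides sends \<open>(i, g, \<lambda>)\<close> to \<open>(1, g, 1)\<close>, since the entries of the
  sandwich matrix that it meets lie in the normalized row and column.
\<close>

lemma component_G_if_related:
  assumes r: "((i, g, l), (j, h, m)) \<in> \<rho>"
  shows "(g, h) \<in> comp_G \<rho>"
proof -
  have c: "i \<in> I" "g \<in> carrier G" "l \<in> \<Lambda>" "j \<in> I" "h \<in> carrier G" "m \<in> \<Lambda>"
    using rees_congruenceD(1)[OF r] by auto
  have e: "((i1, \<one>, l1), (i1, \<one>, l1)) \<in> \<rho>" by (intro rees_congruenceD(2)) auto
  from rees_congruenceD(5)[OF rees_congruenceD(5)[OF e r] e] show ?thesis
    using c by (simp add: component_G_def)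
qed

text \<open>
  The instance \<open>\<lambda> = 1\<close> of the definition is enough: multiplication by \<open>(1, e, \<lambda>)\<close> from the left turns
  it into \<open>p\<^bsub>\<lambda>i\<^esub> \<rho>\<^sub>G p\<^bsub>\<lambda>j\<^esub>\<close>, which recovers the other instances as
  \<open>(i, p\<^bsub>\<lambda>i\<^esub>\<^sup>-\<^sup>1, \<lambda>) = (i, e, 1) (1, p\<^bsub>\<lambda>i\<^esub>\<^sup>-\<^sup>1, 1) (1, e, \<lambda>)\<close>.
\<close>

lemma component_I_iff:
  "(i, j) \<in> comp_I \<rho> \<longleftrightarrow> ((i, \<one>, l1), (j, \<one>, l1)) \<in> \<rho>"
proof
  assume "(i, j) \<in> comp_I \<rho>"
  then have "i \<in> I" "j \<in> I" "((i, inv (P l1 i), l1), (j, inv (P l1 j), l1)) \<in> \<rho>"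
    using l1 unfolding component_I_def by blast+
  then show "((i, \<one>, l1), (j, \<one>, l1)) \<in> \<rho>" by simp
next
  assume r: "((i, \<one>, l1), (j, \<one>, l1)) \<in> \<rho>"
  have c: "i \<in> I" "j \<in> I" using rees_congruenceD(1)[OF r] by auto
  have "((i, inv (P l i), l), (j, inv (P l j), l)) \<in> \<rho>" if l: "l \<in> \<Lambda>" for l
  proof -
    have "((i1, \<one>, l), (i1, \<one>, l)) \<in> \<rho>" using l by (intro rees_congruenceD(2)) auto
    from rees_congruenceD(5)[OF this r] have "(P l i, P l j) \<in> comp_G \<rho>"
      using c l by (intro component_G_if_related[of i1 _ l1 i1 _ l1]) simp
    then have "(inv (P l i), inv (P l j)) \<in> comp_G \<rho>"
      by (rule group_congruenceD(7)[OF component_G_congruence])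
    then have inv: "((i1, inv (P l i), l1), (i1, inv (P l j), l1)) \<in> \<rho>"
      by (simp add: component_G_def)
    have e: "((i1, \<one>, l), (i1, \<one>, l)) \<in> \<rho>" using l by (intro rees_congruenceD(2)) auto
    from rees_congruenceD(5)[OF rees_congruenceD(5)[OF r inv] e] show ?thesis
      using c l by simp
  qed
  then show "(i, j) \<in> comp_I \<rho>" using c by (simp add: component_I_def)
qed

lemma component_Lambda_iff:
  "(l, m) \<in> comp_\<Lambda> \<rho> \<longleftrightarrow> ((i1, \<one>, l), (i1, \<one>, m)) \<in> \<rho>"
proof
  assume "(l, m) \<in> comp_\<Lambda> \<rho>"
  then have "l \<in> \<Lambda>" "m \<in> \<Lambda>" "((i1, inv (P l i1), l), (i1, inv (P m i1), m)) \<in> \<rho>"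
    using i1 unfolding component_Lambda_def by blast+
  then show "((i1, \<one>, l), (i1, \<one>, m)) \<in> \<rho>" by simp
next
  assume r: "((i1, \<one>, l), (i1, \<one>, m)) \<in> \<rho>"
  have c: "l \<in> \<Lambda>" "m \<in> \<Lambda>" using rees_congruenceD(1)[OF r] by auto
  have "((i, inv (P l i), l), (i, inv (P m i), m)) \<in> \<rho>" if i: "i \<in> I" for i
  proof -
    have e: "((i, \<one>, l1), (i, \<one>, l1)) \<in> \<rho>" using i by (intro rees_congruenceD(2)) auto
    from rees_congruenceD(5)[OF r e] have "(P l i, P m i) \<in> comp_G \<rho>"
      using c i by (intro component_G_if_related[of i1 _ l1 i1 _ l1]) simp
    then have "(inv (P l i), inv (P m i)) \<in> comp_G \<rho>"
      by (rule group_congruenceD(7)[OF component_G_congruence])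
    then have "((i1, inv (P l i), l1), (i1, inv (P m i), l1)) \<in> \<rho>"
      by (simp add: component_G_def)
    from rees_congruenceD(5)[OF rees_congruenceD(5)[OF e this] r] show ?thesis
      using c i by simp
  qed
  then show "(l, m) \<in> comp_\<Lambda> \<rho>" using c by (simp add: component_Lambda_def)
qed

text \<open>
  One direction is the factorization \<open>(i, g, \<lambda>) = (i, e, 1) (1, g, 1) (1, e, \<lambda>)\<close>; for the other one,
  multiplication by \<open>(1, g\<^sup>-\<^sup>1, 1)\<close> and \<open>(1, h\<^sup>-\<^sup>1, 1)\<close> on one side removes the group entries.
\<close>

lemma related_iff_components:
  "((i, g, l), (j, h, m)) \<in> \<rho> \<longleftrightarrow>
     (i, j) \<in> comp_I \<rho> \<and> (g, h) \<in> comp_G \<rho> \<and> (l, m) \<in> comp_\<Lambda> \<rho>"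
proof (intro iffI conjI)
  assume r: "((i, g, l), (j, h, m)) \<in> \<rho>"
  have c: "i \<in> I" "g \<in> carrier G" "l \<in> \<Lambda>" "j \<in> I" "h \<in> carrier G" "m \<in> \<Lambda>"
    using rees_congruenceD(1)[OF r] by auto
  show gh: "(g, h) \<in> comp_G \<rho>" by (rule component_G_if_related[OF r])
  then have "(inv g, inv h) \<in> comp_G \<rho>"
    by (rule group_congruenceD(7)[OF component_G_congruence])
  then have inv: "((i1, inv g, l1), (i1, inv h, l1)) \<in> \<rho>" by (simp add: component_G_def)
  from rees_congruenceD(5)[OF r inv] show "(i, j) \<in> comp_I \<rho>"
    using c by (simp add: component_I_iff)
  from rees_congruenceD(5)[OF inv r] show "(l, m) \<in> comp_\<Lambda> \<rho>"
    using c by (simp add: component_Lambda_iff)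
next
  assume "(i, j) \<in> comp_I \<rho> \<and> (g, h) \<in> comp_G \<rho> \<and> (l, m) \<in> comp_\<Lambda> \<rho>"
  then have r: "((i, \<one>, l1), (j, \<one>, l1)) \<in> \<rho>" "((i1, g, l1), (i1, h, l1)) \<in> \<rho>"
    "((i1, \<one>, l), (i1, \<one>, m)) \<in> \<rho>"
    by (simp_all add: component_I_iff component_Lambda_iff component_G_def)
  from rees_congruenceD(5)[OF rees_congruenceD(5)[OF r(1,2)] r(3)]
  show "((i, g, l), (j, h, m)) \<in> \<rho>"
    using rees_congruenceD(1)[OF r(1)] rees_congruenceD(1)[OF r(2)] rees_congruenceD(1)[OF r(3)]
    by simp
qed

lemma component_I_refl: "i \<in> I \<Longrightarrow> (i, i) \<in> comp_I \<rho>"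
  by (simp add: component_I_iff rees_congruenceD(2))

lemma component_Lambda_refl: "l \<in> \<Lambda> \<Longrightarrow> (l, l) \<in> comp_\<Lambda> \<rho>"
  by (simp add: component_Lambda_iff rees_congruenceD(2))

lemma sandwich_matrix_congruent:
  assumes l: "(l, m) \<in> comp_\<Lambda> \<rho>" and i: "(i, j) \<in> comp_I \<rho>"
  shows "(P l i, P m j) \<in> comp_G \<rho>"
proof -
  have r: "((i1, \<one>, l), (i1, \<one>, m)) \<in> \<rho>" "((i, \<one>, l1), (j, \<one>, l1)) \<in> \<rho>"
    using l i by (simp_all add: component_I_iff component_Lambda_iff)
  from rees_congruenceD(5)[OF r] have "((i1, P l i, l1), (i1, P m j, l1)) \<in> \<rho>"
    using rees_congruenceD(1)[OF r(1)] rees_congruenceD(1)[OF r(2)] by simp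
  then show ?thesis by (rule component_G_if_related)
qed

end

section \<open>The upper bound for the commutator\<close>

text \<open>
  The congruence of the linked triple \<open>(0\<^sub>I, \<tau>, 0\<^sub>\<Lambda>)\<close>.
\<close>

definition group_part_congruence :: "'a rel \<Rightarrow> ('i \<times> 'a \<times> 'l) rel" where
  "group_part_congruence \<tau> = {((i, g, l), (j, h, m)). i \<in> I \<and> j = i \<and> (g, h) \<in> \<tau> \<and> l \<in> \<Lambda> \<and> m = l}"

lemma group_part_congruence:
  assumes \<tau>: "is_congruence (group_algebra G) \<tau>"
  shows "is_congruence S (group_part_congruence \<tau>)"
proof -
  note D = group_congruenceD[OF \<tau>]
  have "equiv (I \<times> carrier G \<times> \<Lambda>) (group_part_congruence \<tau>)"
  proof (rule equivI)
    show "group_part_congruence \<tau> \<subseteq> (I \<times> carrier G \<times> \<Lambda>) \<times> (I \<times> carrier G \<times> \<Lambda>)"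
      using D(1,2) unfolding group_part_congruence_def by blast
    show "refl_on (I \<times> carrier G \<times> \<Lambda>) (group_part_congruence \<tau>)"
      by (auto simp: group_part_congruence_def refl_on_def D(3))
    show "sym (group_part_congruence \<tau>)"
      by (rule symI) (auto simp: group_part_congruence_def intro: D(4))
    show "trans (group_part_congruence \<tau>)"
      by (rule transI) (auto simp: group_part_congruence_def intro: D(5))
  qed
  then show ?thesis
    using D(3,6) by (auto simp: rees_congruence_iff group_part_congruence_def)
qed

text \<open>
  The squares that occur in the outer coordinates of term values: constant along rows (with columns
  in \<open>\<alpha>\<close>) if the outermost factor of the term is the distinguished variable, and constant along
  columns (with rows in \<open>\<beta>\<close>) otherwise.
\<close>

definition flat_square :: "'x rel \<Rightarrow> 'x rel \<Rightarrow> 'x \<Rightarrow> 'x \<Rightarrow> 'x \<Rightarrow> 'x \<Rightarrow> bool" where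
  "flat_square \<alpha> \<beta> x y z w \<longleftrightarrow>
     x = y \<and> z = w \<and> (x, z) \<in> \<alpha> \<or> x = z \<and> y = w \<and> (x, y) \<in> \<beta>"

context
  fixes \<rho> \<sigma> :: "('i \<times> 'a \<times> 'l) rel"
  assumes \<rho>: "is_congruence S \<rho>" and \<sigma>: "is_congruence S \<sigma>"
begin

lemma Theta_contains:
  assumes "i \<in> I" "j \<in> I" "l \<in> \<Lambda>" "m \<in> \<Lambda>"
    and "(i, j) \<in> comp_I \<rho> \<and> (l, m) \<in> comp_\<Lambda> \<sigma> \<or> (l, m) \<in> comp_\<Lambda> \<rho> \<and> (i, j) \<in> comp_I \<sigma>"
  shows "(P m i \<otimes> inv (P l i), P m j \<otimes> inv (P l j)) \<in> Theta G I \<Lambda> P \<rho> \<sigma>"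
  unfolding Theta_def
  by (rule set_mp[OF generated_congruence_least(2)[OF is_algebra_group_algebra[OF is_group]]])
    (use assms in \<open>auto simp: group_algebra_def\<close>)

lemma Theta_congruence: "is_congruence (group_algebra G) (Theta G I \<Lambda> P \<rho> \<sigma>)"
  unfolding Theta_def
  by (rule generated_congruence_least(1)[OF is_algebra_group_algebra[OF is_group]])
    (auto simp: group_algebra_def)

lemma Theta_least:
  assumes "is_congruence (group_algebra G) \<theta>"
    and "\<And>i j l m. \<lbrakk>i \<in> I; j \<in> I; l \<in> \<Lambda>; m \<in> \<Lambda>; (i, j) \<in> comp_I \<rho>; (l, m) \<in> comp_\<Lambda> \<sigma>\<rbrakk>
      \<Longrightarrow> (P m i \<otimes> inv (P l i), P m j \<otimes> inv (P l j)) \<in> \<theta>"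
    and "\<And>i j l m. \<lbrakk>i \<in> I; j \<in> I; l \<in> \<Lambda>; m \<in> \<Lambda>; (l, m) \<in> comp_\<Lambda> \<rho>; (i, j) \<in> comp_I \<sigma>\<rbrakk>
      \<Longrightarrow> (P m i \<otimes> inv (P l i), P m j \<otimes> inv (P l j)) \<in> \<theta>"
  shows "Theta G I \<Lambda> P \<rho> \<sigma> \<subseteq> \<theta>"
  unfolding Theta_def
  by (rule generated_congruence_least(3)[OF is_algebra_group_algebra[OF is_group]])
    (use assms in \<open>auto simp: group_algebra_def\<close>)

text \<open>
  When two factors are multiplied, the entry of the sandwich matrix between them is picked by flat
  squares of indices. If both are constant in the same direction, so is the square of entries, and
  its quotients agree. If the directions differ, the square is
  a full \<open>2 \<times> 2\<close> minor of the matrix with one index pair in a component of \<open>\<rho>\<close> and the other one in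
  a component of \<open>\<sigma>\<close>, which is exactly the situation in the two kinds of generators of \<open>\<Theta>\<close>.
\<close>

lemma central_square_sandwich_matrix:
  assumes \<tau>: "is_congruence (group_algebra G) \<tau>"
    and commute: "commute_modulo (comp_G \<rho>) (comp_G \<sigma>) \<tau>"
    and Theta: "Theta G I \<Lambda> P \<rho> \<sigma> \<subseteq> \<tau>"
    and L: "flat_square (comp_\<Lambda> \<rho>) (comp_\<Lambda> \<sigma>) l l' m m'"
    and I: "flat_square (comp_I \<rho>) (comp_I \<sigma>) i i' j j'"
  shows "central_square (comp_G \<rho>) (comp_G \<sigma>) \<tau> (P l i) (P l' i') (P m j) (P m' j')"
proof -
  note G\<rho> = component_G_congruence[OF \<rho>] and G\<sigma> = component_G_congruence[OF \<sigma>]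
  have in\<Lambda>: "l \<in> \<Lambda>" "l' \<in> \<Lambda>" "m \<in> \<Lambda>" "m' \<in> \<Lambda>"
    using L by (auto simp: flat_square_def component_Lambda_def)
  have inI: "i \<in> I" "i' \<in> I" "j \<in> I" "j' \<in> I"
    using I by (auto simp: flat_square_def component_I_def)
  note refl = component_I_refl component_Lambda_refl
  have sides: "(P l i, P l' i') \<in> comp_G \<sigma>" "(P m j, P m' j') \<in> comp_G \<sigma>"
    "(P l i, P m j) \<in> comp_G \<rho>" "(P l' i', P m' j') \<in> comp_G \<rho>"
    using L I in\<Lambda> inI refl[OF \<rho>] refl[OF \<sigma>]
      sandwich_matrix_congruent[OF \<rho>] sandwich_matrix_congruent[OF \<sigma>]
    by (auto simp: flat_square_def)
  consider
      (rows) "l = l'" "m = m'" "i = i'" "j = j'"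
    | (columns) "l = m" "l' = m'" "i = j" "i' = j'"
    | (mixed1) "l = l'" "m = m'" "(l, m) \<in> comp_\<Lambda> \<rho>" "i = j" "i' = j'" "(i, i') \<in> comp_I \<sigma>"
    | (mixed2) "l = m" "l' = m'" "(l, l') \<in> comp_\<Lambda> \<sigma>" "i = i'" "j = j'" "(i, j) \<in> comp_I \<rho>"
    using L I by (auto simp: flat_square_def)
  then have "(P m j \<otimes> inv (P l i), P m' j' \<otimes> inv (P l' i')) \<in> \<tau>"
  proof cases
    case rows
    then show ?thesis using in\<Lambda> inI by (auto intro: group_congruenceD(3)[OF \<tau>])
  next
    case columns
    then show ?thesis using in\<Lambda> inI group_congruenceD(3)[OF \<tau> one_closed] by simp
  next
    case mixed1
    then show ?thesis using Theta_contains[of i i' l m] Theta in\<Lambda> inI by auto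
  next
    case mixed2
    \<comment> \<open>Here the generator of \<open>\<Theta>\<close> compares \<open>b a\<^sup>-\<^sup>1\<close> with \<open>d c\<^sup>-\<^sup>1\<close> along the rows, whereas the square
      requires \<open>c a\<^sup>-\<^sup>1\<close> and \<open>d b\<^sup>-\<^sup>1\<close> to agree. Since \<open>c a\<^sup>-\<^sup>1\<close> is the conjugate of \<open>a\<^sup>-\<^sup>1 c\<close> by \<open>a\<close>, it
      agrees with the conjugate by \<open>b\<close>, which is \<open>(b a\<^sup>-\<^sup>1) (c b\<^sup>-\<^sup>1)\<close>, hence with
      \<open>(d c\<^sup>-\<^sup>1) (c b\<^sup>-\<^sup>1) = d b\<^sup>-\<^sup>1\<close>.\<close>
    let ?a = "P l i" and ?b = "P l' i" and ?c = "P l j" and ?d = "P l' j"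
    have c: "?a \<in> carrier G" "?b \<in> carrier G" "?c \<in> carrier G" "?d \<in> carrier G"
      using in\<Lambda> inI by auto
    have \<theta>: "(?b \<otimes> inv ?a, ?d \<otimes> inv ?c) \<in> \<tau>"
      using Theta_contains[of i j l l'] Theta in\<Lambda> inI mixed2 by auto
    note D = group_congruenceD[OF \<tau>]
    have "(?a, ?b) \<in> comp_G \<sigma>" using sides mixed2 by simp
    moreover have "(inv ?a \<otimes> ?c, \<one>) \<in> comp_G \<rho>"
      using group_congruenceD(6)[OF G\<rho> group_congruenceD(3)[OF G\<rho>, of "inv ?a"]
          group_congruenceD(4)[OF G\<rho> sides(3)]] mixed2 c by simp
    moreover have "(inv ?a \<otimes> ?c, inv ?a \<otimes> ?c) \<in> \<tau>" using c by (intro D(3)) auto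
    ultimately have "(?a \<otimes> (inv ?a \<otimes> ?c) \<otimes> inv ?a, ?b \<otimes> (inv ?a \<otimes> ?c) \<otimes> inv ?b) \<in> \<tau>"
      by (rule conjugate_modulo[OF G\<rho> G\<sigma> \<tau> commute])
    then have "(?c \<otimes> inv ?a, ?b \<otimes> inv ?a \<otimes> (?c \<otimes> inv ?b)) \<in> \<tau>"
      using c by (simp add: m_assoc)
    moreover have "(?b \<otimes> inv ?a \<otimes> (?c \<otimes> inv ?b), ?d \<otimes> inv ?c \<otimes> (?c \<otimes> inv ?b)) \<in> \<tau>"
      using c by (intro D(6)[OF \<theta>] D(3)) auto
    ultimately have "(?c \<otimes> inv ?a, ?d \<otimes> inv ?c \<otimes> (?c \<otimes> inv ?b)) \<in> \<tau>" by (rule D(5))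
    then show ?thesis using c mixed2 by (simp add: m_assoc)
  qed
  with sides show ?thesis by (simp add: central_square_def)
qed

text \<open>
  The invariant relation consists of the squares that are flat in both outer coordinates and central
  in the group coordinate. If the first row of such a square has equal outer entries, then so does
  the second row, whichever way the square is flat.
\<close>

proposition centralizes_group_part_congruence:
  assumes \<tau>: "is_congruence (group_algebra G) \<tau>"
    and commute: "commute_modulo (comp_G \<rho>) (comp_G \<sigma>) \<tau>"
    and Theta: "Theta G I \<Lambda> P \<rho> \<sigma> \<subseteq> \<tau>"
  shows "centralizes S \<rho> \<sigma> (group_part_congruence \<tau>)"
proof -
  note G\<rho> = component_G_congruence[OF \<rho>] and G\<sigma> = component_G_congruence[OF \<sigma>]
  note square_mult = central_square_mult[OF G\<rho> G\<sigma> \<tau> commute]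
    and square_P = central_square_sandwich_matrix[OF \<tau> commute Theta]
  define Q where "Q x y z w \<longleftrightarrow>
      flat_square (comp_I \<rho>) (comp_I \<sigma>) (fst x) (fst y) (fst z) (fst w) \<and>
      central_square (comp_G \<rho>) (comp_G \<sigma>) \<tau>
        (fst (snd x)) (fst (snd y)) (fst (snd z)) (fst (snd w)) \<and>
      flat_square (comp_\<Lambda> \<rho>) (comp_\<Lambda> \<sigma>)
        (snd (snd x)) (snd (snd y)) (snd (snd z)) (snd (snd w))"
    for x y z w :: "'i \<times> 'a \<times> 'l"
  have Q_mult: "Q (rees_mult G P x x') (rees_mult G P y y') (rees_mult G P z z') (rees_mult G P w w')"
    if "Q x y z w" "Q x' y' z' w'" for x y z w x' y' z' w'
    using that unfolding Q_def
    by (cases x; cases y; cases z; cases w; cases x'; cases y'; cases z'; cases w')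
      (auto intro!: square_mult square_P)
  show ?thesis
  proof (rule centralizes_if_invariant_relation[where Q = Q])
    fix n f xs ys zs ws
    assume "(n, f) \<in> operations S" "\<And>i. i < n \<Longrightarrow> Q (xs ! i) (ys ! i) (zs ! i) (ws ! i)"
    then show "Q (f xs) (f ys) (f zs) (f ws)"
      by (auto simp: rees_algebra_def intro!: Q_mult)
  next
    show "Q a a b b" if "(a, b) \<in> \<rho>" for a b
      using that central_square_rows[OF G\<rho> G\<sigma> \<tau> commute]
      by (cases a; cases b) (auto simp: Q_def flat_square_def related_iff_components[OF \<rho>])
    show "Q c d c d" if "(c, d) \<in> \<sigma>" for c d
      using that central_square_columns[OF G\<rho> G\<sigma> \<tau> commute]
      by (cases c; cases d) (auto simp: Q_def flat_square_def related_iff_components[OF \<sigma>])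
  next
    fix x y z w assume "Q x y z w" "(x, y) \<in> group_part_congruence \<tau>"
    then show "(z, w) \<in> group_part_congruence \<tau>"
      using central_square_transfer[OF G\<rho> G\<sigma> \<tau> commute]
      by (cases x; cases y; cases z; cases w)
        (auto simp: Q_def group_part_congruence_def flat_square_def component_I_def
          component_Lambda_def)
  qed
qed

section \<open>The lower bound for the commutator\<close>

context
  fixes \<delta> :: "('i \<times> 'a \<times> 'l) rel"
  assumes \<delta>: "is_congruence S \<delta>" and central: "centralizes S \<rho> \<sigma> \<delta>"
begin

lemma rees_sandwich:
  assumes "(a, b) \<in> \<rho>" "(c, d) \<in> \<sigma>" "(c', d') \<in> \<sigma>"
    and "(rees_mult G P (rees_mult G P c a) c', rees_mult G P (rees_mult G P d a) d') \<in> \<delta>"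
  shows "(rees_mult G P (rees_mult G P c b) c', rees_mult G P (rees_mult G P d b) d') \<in> \<delta>"
proof -
  have op: "(2, \<lambda>xs. rees_mult G P (xs ! 0) (xs ! 1)) \<in> operations S"
    by (simp add: rees_algebra_def)
  show ?thesis using centralizes_sandwich[OF central op assms(1-3)] assms(4) by simp
qed

lemma commute_modulo_component_G: "commute_modulo (comp_G \<rho>) (comp_G \<sigma>) (comp_G \<delta>)"
proof (rule commute_moduloI_sandwich)
  fix a b c d c' d'
  assume r: "(a, b) \<in> comp_G \<rho>" "(c, d) \<in> comp_G \<sigma>" "(c', d') \<in> comp_G \<sigma>"
    "(c \<otimes> a \<otimes> c', d \<otimes> a \<otimes> d') \<in> comp_G \<delta>"
  then show "(c \<otimes> b \<otimes> c', d \<otimes> b \<otimes> d') \<in> comp_G \<delta>"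
    using rees_sandwich[of "(i1, a, l1)" "(i1, b, l1)" "(i1, c, l1)" "(i1, d, l1)"
        "(i1, c', l1)" "(i1, d', l1)"]
    by (auto simp: component_G_def)
qed (intro component_G_congruence \<rho> \<sigma> \<delta>)+

text \<open>
  Put \<open>u = p\<^bsub>\<mu>i\<^esub> p\<^bsub>\<lambda>i\<^esub>\<^sup>-\<^sup>1\<close> and \<open>v = p\<^bsub>\<mu>j\<^esub> p\<^bsub>\<lambda>j\<^esub>\<^sup>-\<^sup>1\<close>. The triples \<open>(1, e, \<lambda>)\<close>, \<open>(1, e, \<mu>)\<close> multiply
  \<open>(i, p\<^bsub>\<lambda>i\<^esub>\<^sup>-\<^sup>1, 1)\<close> to group entries \<open>e\<close>, \<open>u\<close> and \<open>(j, p\<^bsub>\<lambda>j\<^esub>\<^sup>-\<^sup>1, 1)\<close> to \<open>e\<close>, \<open>v\<close>. If \<open>\<lambda> \<rho>\<^sub>\<Lambda> \<mu>\<close> and \<open>i \<sigma>\<^sub>I j\<close>,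
  the pair \<open>(e, e)\<close> for \<open>\<lambda>\<close> is thus transferred to the pair \<open>(u, v)\<close> for \<open>\<mu>\<close>. If \<open>i \<rho>\<^sub>I j\<close> and \<open>\<lambda> \<sigma>\<^sub>\<Lambda> \<mu>\<close>,
  the pair for \<open>i\<close> is \<open>(e, u)\<close>; the remaining factor \<open>y'\<close> of the term makes it trivial, by taking the
  values \<open>e\<close> and \<open>u\<^sup>-\<^sup>1\<close>, and the pair for \<open>j\<close> becomes \<open>(e, v u\<^sup>-\<^sup>1)\<close>.
\<close>

lemma Theta_subset_component_G: "Theta G I \<Lambda> P \<rho> \<sigma> \<subseteq> comp_G \<delta>"
proof (rule Theta_least[OF component_G_congruence[OF \<delta>]])
  note G\<rho> = component_G_congruence[OF \<rho>] and G\<sigma> = component_G_congruence[OF \<sigma>]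
    and G\<delta> = component_G_congruence[OF \<delta>]
  have refl\<delta>: "((i1, \<one>, l1), (i1, \<one>, l1)) \<in> \<delta>" by (rule rees_congruenceD(2)[OF \<delta>]) auto
  fix i j l m
  assume c: "i \<in> I" "j \<in> I" "l \<in> \<Lambda>" "m \<in> \<Lambda>" and r: "(i, j) \<in> comp_I \<rho>" "(l, m) \<in> comp_\<Lambda> \<sigma>"
  define u where "u = P m i \<otimes> inv (P l i)"
  define v where "v = P m j \<otimes> inv (P l j)"
  have uv: "u \<in> carrier G" "v \<in> carrier G" using c by (auto simp: u_def v_def)
  have "(P l i, P l j) \<in> comp_G \<rho>"
    using sandwich_matrix_congruent[OF \<rho> component_Lambda_refl[OF \<rho>] r(1)] c by simp
  from group_congruenceD(7)[OF G\<rho> this]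
  have 1: "((i, inv (P l i), l1), (j, inv (P l j), l1)) \<in> \<rho>"
    using r component_Lambda_refl[OF \<rho>] by (simp add: related_iff_components[OF \<rho>])
  have 2: "((i1, \<one>, l), (i1, \<one>, m)) \<in> \<sigma>" using r component_Lambda_iff[OF \<sigma>] by simp
  have "(P l i, P m i) \<in> comp_G \<sigma>"
    using sandwich_matrix_congruent[OF \<sigma> r(2) component_I_refl[OF \<sigma>]] c by simp
  from group_congruenceD(4)[OF G\<sigma> this] have "(u, \<one>) \<in> comp_G \<sigma>"
    using c by (simp add: u_def group_congruence_right_quotient_iff[OF G\<sigma>])
  from group_congruenceD(7)[OF G\<sigma> group_congruenceD(4)[OF G\<sigma> this]]
  have 3: "((i1, \<one>, l1), (i1, inv u, l1)) \<in> \<sigma>" by (simp add: component_G_def)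
  have "((i1, \<one>, l1), (i1, v \<otimes> inv u, l1)) \<in> \<delta>"
    using rees_sandwich[OF 1 2 3] uv c refl\<delta> by (simp add: u_def[symmetric] v_def[symmetric])
  then have "(\<one>, v \<otimes> inv u) \<in> comp_G \<delta>" using uv by (simp add: component_G_def)
  from group_congruenceD(4)[OF G\<delta> this] have "(v, u) \<in> comp_G \<delta>"
    using uv by (simp add: group_congruence_right_quotient_iff[OF G\<delta>])
  then show "(u, v) \<in> comp_G \<delta>" by (rule group_congruenceD(4)[OF G\<delta>])
next
  note G\<sigma> = component_G_congruence[OF \<sigma>]
  have refl\<delta>: "((i1, \<one>, l1), (i1, \<one>, l1)) \<in> \<delta>" by (rule rees_congruenceD(2)[OF \<delta>]) auto
  fix i j l m
  assume c: "i \<in> I" "j \<in> I" "l \<in> \<Lambda>" "m \<in> \<Lambda>" and r: "(l, m) \<in> comp_\<Lambda> \<rho>" "(i, j) \<in> comp_I \<sigma>"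
  have 1: "((i1, \<one>, l), (i1, \<one>, m)) \<in> \<rho>" using r component_Lambda_iff[OF \<rho>] by simp
  have 2: "((i1, \<one>, l1), (i1, \<one>, l1)) \<in> \<sigma>" by (rule rees_congruenceD(2)[OF \<sigma>]) auto
  have "(P l i, P l j) \<in> comp_G \<sigma>"
    using sandwich_matrix_congruent[OF \<sigma> component_Lambda_refl[OF \<sigma>] r(2)] c by simp
  from group_congruenceD(7)[OF G\<sigma> this]
  have 3: "((i, inv (P l i), l1), (j, inv (P l j), l1)) \<in> \<sigma>"
    using r component_Lambda_refl[OF \<sigma>] by (simp add: related_iff_components[OF \<sigma>])
  show "(P m i \<otimes> inv (P l i), P m j \<otimes> inv (P l j)) \<in> comp_G \<delta>"
    using rees_sandwich[OF 1 2 3] c refl\<delta> by (simp add: component_G_def)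
qed

end

section \<open>The components of the commutator\<close>

text \<open>
  The upper bound makes both outer components trivial and bounds the group component by \<open>\<tau>\<close>; the lower
  bound applies to the commutator itself, because \<open>\<rho>\<close> centralizes \<open>\<sigma>\<close> modulo it.
\<close>

theorem components_commutator:
  defines "\<tau> \<equiv> congruence_join (group_algebra G)
      (commutator (group_algebra G) (comp_G \<rho>) (comp_G \<sigma>)) (Theta G I \<Lambda> P \<rho> \<sigma>)"
  shows "linked_triple G I \<Lambda> P (Id_on I) \<tau> (Id_on \<Lambda>)"
    and "comp_I (commutator S \<rho> \<sigma>) = Id_on I"
    and "comp_G (commutator S \<rho> \<sigma>) = \<tau>"
    and "comp_\<Lambda> (commutator S \<rho> \<sigma>) = Id_on \<Lambda>"
proof -
  note alg = is_algebra_group_algebra[OF is_group]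
  note G\<rho> = component_G_congruence[OF \<rho>] and G\<sigma> = component_G_congruence[OF \<sigma>]
  let ?c = "commutator (group_algebra G) (comp_G \<rho>) (comp_G \<sigma>)"
  note comm_G = commutator_least[OF alg G\<rho> G\<sigma>]
  note join = congruence_join_least[OF alg comm_G(1) Theta_congruence, folded \<tau>_def]
  have "is_algebra S" by (rule is_algebra_rees_algebra[OF is_group]) simp
  note comm = commutator_least[OF this \<rho> \<sigma>]
  note G_comm = component_G_congruence[OF comm(1)]

  have "commute_modulo (comp_G \<rho>) (comp_G \<sigma>) ?c"
    using comm_G(1,2) centralizes_group_iff[OF G\<rho> G\<sigma>] by blast
  then have "commute_modulo (comp_G \<rho>) (comp_G \<sigma>) \<tau>"
    using join(2) unfolding commute_modulo_def by blast
  then have below: "commutator S \<rho> \<sigma> \<subseteq> group_part_congruence \<tau>"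
    by (intro comm(3) group_part_congruence centralizes_group_part_congruence join(1,3))

  have "?c \<subseteq> comp_G (commutator S \<rho> \<sigma>)"
    using commute_modulo_component_G[OF comm(1,2)]
    by (intro comm_G(3)[OF G_comm]) (simp add: centralizes_group_iff[OF G\<rho> G\<sigma> G_comm])
  then have above: "\<tau> \<subseteq> comp_G (commutator S \<rho> \<sigma>)"
    by (intro join(4)[OF G_comm] Theta_subset_component_G[OF comm(1,2)])

  show "comp_G (commutator S \<rho> \<sigma>) = \<tau>"
    using below above by (auto simp: component_G_def group_part_congruence_def)
  show "comp_I (commutator S \<rho> \<sigma>) = Id_on I"
    using below component_I_refl[OF comm(1)] component_I_iff[OF comm(1)]
    by (auto simp: group_part_congruence_def)
  show "comp_\<Lambda> (commutator S \<rho> \<sigma>) = Id_on \<Lambda>"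
    using below component_Lambda_refl[OF comm(1)] component_Lambda_iff[OF comm(1)]
    by (auto simp: group_part_congruence_def)

  have "(P l i \<otimes> inv (P m i) \<otimes> P m j \<otimes> inv (P l j), \<one>) \<in> \<tau>"
    if "i \<in> I" "j \<in> I" "l \<in> \<Lambda>" "m \<in> \<Lambda>" "(i, j) \<in> Id_on I \<or> (l, m) \<in> Id_on \<Lambda>" for i j l m
  proof -
    have "P l i \<otimes> inv (P m i) \<otimes> P m j \<otimes> inv (P l j) = \<one>"
      using that by (auto simp: m_assoc)
    then show ?thesis using group_congruenceD(3)[OF join(1) one_closed] by simp
  qed
  moreover have "equiv I (Id_on I)" "equiv \<Lambda> (Id_on \<Lambda>)"
    by (auto intro!: equivI refl_onI symI transI)
  ultimately show "linked_triple G I \<Lambda> P (Id_on I) \<tau> (Id_on \<Lambda>)"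
    using join(1) by (auto simp: linked_triple_def)
qed

end

end

theorem theorem1p1:
  fixes G :: "('g, 'b) monoid_scheme"
    and I :: "'i set" and \<Lambda> :: "'l set" and i1 :: 'i and l1 :: 'l
    and P :: "'l \<Rightarrow> 'i \<Rightarrow> 'g"
    and \<rho> \<sigma> :: "('i \<times> 'g \<times> 'l) rel"
  defines "S \<equiv> rees_algebra G I \<Lambda> P"
  assumes "group G"
    and "i1 \<in> I" and "l1 \<in> \<Lambda>"
    and "\<And>l i. l \<in> \<Lambda> \<Longrightarrow> i \<in> I \<Longrightarrow> P l i \<in> carrier G"
    and "\<And>i. i \<in> I \<Longrightarrow> P l1 i = \<one>\<^bsub>G\<^esub>"
    and "\<And>l. l \<in> \<Lambda> \<Longrightarrow> P l i1 = \<one>\<^bsub>G\<^esub>"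
    and "is_congruence S \<rho>" and "is_congruence S \<sigma>"
  defines "\<tau> \<equiv> congruence_join (group_algebra G)
      (commutator (group_algebra G) (component_G G i1 l1 \<rho>) (component_G G i1 l1 \<sigma>))
      (Theta G I \<Lambda> P \<rho> \<sigma>)"
  shows "linked_triple G I \<Lambda> P (Id_on I) \<tau> (Id_on \<Lambda>)
    \<and> component_I G I \<Lambda> P (commutator S \<rho> \<sigma>) = Id_on I
    \<and> component_G G i1 l1 (commutator S \<rho> \<sigma>) = \<tau>
    \<and> component_Lambda G I \<Lambda> P (commutator S \<rho> \<sigma>) = Id_on \<Lambda>"
proof -
  interpret normalized_rees G I \<Lambda> i1 l1 P
    using assms(2-7) by (auto simp: normalized_rees_def normalized_rees_axioms_def)
  show ?thesis
    using components_commutator assms(8,9) unfolding S_def \<tau>_def by blast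
qed

end
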